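(* Suppose the agents have binary values, i.e., for every item $t$ there is a number $v_t$ such that $v_{it}\in\{0,v_t\}$ for every agent $i$. Then the Myopic Greedy online algorithm is $O(\log\mu^* )$-competitive, where $\mu^*$ is the impartiality ratio of the instance.
   Context: There are $N$ agents and $T$ divisible items arriving online in the order $t=1,\dots,T$. Item $t$ has supply $s_t>0$ and agent $i$ has value $v_{it}\ge 0$ per unit of item $t$. An allocation is a non-negative vector $(x_{it})$ with $\sum_{i} x_{it}\le s_t$; agent $i$'s utility is $u_i=\sum_t x_{it}v_{it}$, and the Nash welfare is $(\prod_{i=1}^N u_i)^{1/N}$. An online algorithm allocates each item irrevocably upon its arrival. An algorithm is $\Gamma$-competitive if on every instance (in the considered class), the optimal Nash welfare is at most $\Gamma$ times the (expected) Nash welfare of the algorithm. An allocation with utilities $(u_i)$ is $\mu$-impartial if $u_i\le\mu u_j$ for all $i,j$; an instance is $\mu$-impartial if every Nash welfare maximizing allocation is $\mu$-impartial; $\mu^*$ is the smallest such $\mu$. Myopic Greedy: for each arriving item $t$, choose $(x_{it})_i$ maximizing $\sum_{i=1}^N\log\big(\sum_{t'<t}v_{it'}x_{it'}+v_{it}x_{it}\big)$ subject to $\sum_i x_{it}\le s_t$, $x_{it}\ge 0$.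
   Formalization: O(log μ* ) is read as C(1+log μ* ) with an absolute constant C, since log μ* = 0 at μ* = 1; and in the Myopic Greedy objective the terms log 0 of agents with zero utility so far and zero value for the item are omitted. *)

theory Defs
  imports "HOL-Analysis.Analysis"
begin

text \<open>Agents are \<open>0, \<dots>, N - 1\<close>; items are \<open>0, \<dots>, T - 1\<close> and arrive in this order. The functions in an
  instance, and allocations, carry no information outside these ranges.\<close>

record nw_instance =
  agents :: nat
  items :: nat
  item_supply :: "nat \<Rightarrow> real"
  value_of :: "nat \<Rightarrow> nat \<Rightarrow> real"  \<comment> \<open>\<open>value_of I i t\<close>: value of agent \<open>i\<close> per unit of item \<open>t\<close>\<close>

type_synonym alloc = "nat \<Rightarrow> nat \<Rightarrow> real"  \<comment> \<open>\<open>x i t\<close>: amount of item \<open>t\<close> given to agent \<open>i\<close>\<close>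

definition valid_instance :: "nw_instance \<Rightarrow> bool" where
  "valid_instance I \<longleftrightarrow>
     0 < agents I \<and>
     (\<forall>t<items I. 0 < item_supply I t) \<and>
     (\<forall>i<agents I. \<forall>t<items I. 0 \<le> value_of I i t)"

definition binary_instance :: "nw_instance \<Rightarrow> bool" where
  "binary_instance I \<longleftrightarrow>
     (\<forall>t<items I. \<exists>w. \<forall>i<agents I. value_of I i t \<in> {0, w})"

definition item_feasible :: "nw_instance \<Rightarrow> nat \<Rightarrow> (nat \<Rightarrow> real) \<Rightarrow> bool" where
  "item_feasible I t z \<longleftrightarrow>
     (\<forall>i<agents I. 0 \<le> z i) \<and> (\<Sum>i<agents I. z i) \<le> item_supply I t"

definition allocation :: "nw_instance \<Rightarrow> alloc \<Rightarrow> bool" where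
  "allocation I x \<longleftrightarrow> (\<forall>t<items I. item_feasible I t (\<lambda>i. x i t))"

definition utility_before :: "nw_instance \<Rightarrow> alloc \<Rightarrow> nat \<Rightarrow> nat \<Rightarrow> real" where
  "utility_before I x t i = (\<Sum>t'<t. x i t' * value_of I i t')"

definition utility :: "nw_instance \<Rightarrow> alloc \<Rightarrow> nat \<Rightarrow> real" where
  "utility I x i = (\<Sum>t<items I. x i t * value_of I i t)"

definition nash_welfare :: "nw_instance \<Rightarrow> alloc \<Rightarrow> real" where
  "nash_welfare I x = root (agents I) (\<Prod>i<agents I. utility I x i)"

definition opt_nash_welfare :: "nw_instance \<Rightarrow> real" where
  "opt_nash_welfare I = (SUP x\<in>{x. allocation I x}. nash_welfare I x)"

definition nash_optimal :: "nw_instance \<Rightarrow> alloc \<Rightarrow> bool" where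
  "nash_optimal I x \<longleftrightarrow>
     allocation I x \<and> (\<forall>y. allocation I y \<longrightarrow> nash_welfare I y \<le> nash_welfare I x)"

definition impartial_allocation :: "nw_instance \<Rightarrow> real \<Rightarrow> alloc \<Rightarrow> bool" where
  "impartial_allocation I \<mu> x \<longleftrightarrow>
     (\<forall>i<agents I. \<forall>j<agents I. utility I x i \<le> \<mu> * utility I x j)"

definition impartial_instance :: "nw_instance \<Rightarrow> real \<Rightarrow> bool" where
  "impartial_instance I \<mu> \<longleftrightarrow> (\<forall>x. nash_optimal I x \<longrightarrow> impartial_allocation I \<mu> x)"

text \<open>The impartiality ratio \<open>\<mu>\<^sup>*\<close>. The set below is closed, so that the infimum is a minimum
  unless the set is empty; in the latter case \<open>\<mu>\<^sup>* = \<infinity>\<close>, and this happens only if the optimal Nash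
  welfare is 0. The constraint \<open>1 \<le> \<mu>\<close> is automatic (take \<open>i = j\<close>) unless all optimal utilities
  are 0.\<close>

definition impartiality_ratio :: "nw_instance \<Rightarrow> ereal" where
  "impartiality_ratio I = Inf {ereal \<mu> | \<mu>. 1 \<le> \<mu> \<and> impartial_instance I \<mu>}"

text \<open>The natural logarithm with \<open>log 0 = -\<infinity>\<close> and \<open>log \<infinity> = \<infinity>\<close>; note that \<^term>\<open>ln (0::real)\<close> is 0.\<close>

definition elog :: "ereal \<Rightarrow> ereal" where
  "elog a = (if a \<le> 0 then -\<infinity> else if a = \<infinity> then \<infinity> else ereal (ln (real_of_ereal a)))"

text \<open>The objective that Myopic Greedy maximizes over the allocations \<open>z\<close> of item \<open>t\<close>. An agent with
  zero utility so far and zero value for item \<open>t\<close> contributes the term \<open>log 0 = -\<infinity>\<close> whatever \<open>z\<close>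
  is. With these terms the objective would be constantly \<open>-\<infinity>\<close> and would not determine the
  allocation, so they are left out.\<close>

definition greedy_objective :: "nw_instance \<Rightarrow> alloc \<Rightarrow> nat \<Rightarrow> (nat \<Rightarrow> real) \<Rightarrow> ereal" where
  "greedy_objective I x t z =
     (\<Sum>i | i < agents I \<and> (utility_before I x t i > 0 \<or> value_of I i t > 0).
        elog (ereal (utility_before I x t i + value_of I i t * z i)))"

text \<open>\<open>x\<close> is an outcome of Myopic Greedy on \<open>I\<close>, with arbitrary choices among several maximizers.\<close>

definition myopic_greedy :: "nw_instance \<Rightarrow> alloc \<Rightarrow> bool" where
  "myopic_greedy I x \<longleftrightarrow>
     (\<forall>t<items I. item_feasible I t (\<lambda>i. x i t) \<and>
        (\<forall>z. item_feasible I t z \<longrightarrow>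
           greedy_objective I x t z \<le> greedy_objective I x t (\<lambda>i. x i t)))"

text \<open>An algorithm is given by its possible outcomes on each instance, and the competitive ratio
  may depend on the instance. A ratio \<open>O(log \<mu>\<^sup>*)\<close> is to be read as \<open>O(1 + log \<mu>\<^sup>*)\<close>: at \<open>\<mu>\<^sup>* = 1\<close> the
  logarithm is 0, while no competitive ratio is below 1. In products of extended reals,
  \<open>\<infinity> * 0 = 0\<close>.\<close>

definition competitive ::
  "(nw_instance \<Rightarrow> alloc \<Rightarrow> bool) \<Rightarrow> (nw_instance \<Rightarrow> ereal) \<Rightarrow> nw_instance set \<Rightarrow> bool" where
  "competitive A \<Gamma> K \<longleftrightarrow>
     (\<forall>I\<in>K. \<forall>x. A I x \<longrightarrow> ereal (opt_nash_welfare I) \<le> \<Gamma> I * ereal (nash_welfare I x))"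

end

theory Submission
  imports Defs
begin

text \<open>Let \<open>g\<^sub>i\<close> be the greedy utilities and \<open>w\<^sub>i\<close> the optimal ones, scaled so that \<open>1 \<le> w\<^sub>i \<le> \<mu>\<close>. With
  binary values, greedy is water filling: it hands each item out completely, to those agents wanting it
  whose utility afterwards is smallest. So every item that the optimum gives to an agent with \<open>g\<^sub>i \<le> e\<close>
  raises greedy levels below \<open>e\<close> only, and the sum of \<open>w\<^sub>i\<close> over \<open>g\<^sub>i \<le> e\<close> is at most \<open>e N\<close>.

  Split \<open>w\<^sub>i / g\<^sub>i = (1 + 1 / g\<^sub>i) (w\<^sub>i / (1 + g\<^sub>i))\<close>. Sort the agents by \<open>g\<close>. The \<open>k\<close>-th one has
  \<open>g\<^sub>i \<ge> k / N\<close>, so the product of the first factors is at most \<open>(2N choose N) \<le> 4\<^sup>N\<close>. The second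
  factors are bounded through their arithmetic mean: with \<open>S\<close> the sum of \<open>w\<close> up to agent \<open>i\<close>, we have
  \<open>g\<^sub>i \<ge> S / N\<close>, whence \<open>w\<^sub>i / (1 + g\<^sub>i) \<le> N w\<^sub>i / (N + S)\<close>, and these terms sum to at most
  \<open>N ln (1 + \<mu>)\<close> by comparison with an integral. The competitive ratio is thus at most
  \<open>4 ln (1 + \<mu>) \<le> 4 (1 + ln \<mu>)\<close>.\<close>

section \<open>Inequalities from bounds on level sets\<close>

text \<open>Induction in increasing order of \<open>g\<close>. When \<open>a\<close> is added to
  \<open>k\<close> elements, all \<open>k + 1\<close> of them lie in the level set of
  \<open>g a\<close>, so \<open>g a\<close> is at least \<open>(k + 1) / n\<close>. The new factor
  is then at most \<open>1 + n / (k + 1)\<close>, the quotient of the consecutive binomial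
  coefficients.\<close>

lemma prod_one_plus_inverse_le:
  fixes g :: "'a \<Rightarrow> real"
  assumes "finite A" "0 < n" "\<And>i. i \<in> A \<Longrightarrow> 0 < g i"
    and "\<And>e. 0 < e \<Longrightarrow> real (card {i \<in> A. g i \<le> e}) \<le> e * real n"
  shows "(\<Prod>i\<in>A. 1 + 1 / g i) \<le> real ((n + card A) choose card A)"
  using assms(1,3,4)
proof (induction A rule: finite_ranking_induct[where f = g])
  case empty
  then show ?case by simp
next
  case (insert a A)
  show ?case
  proof (cases "a \<in> A")
    case True
    with insert show ?thesis by (simp add: insert_absorb)
  next
    case False
    define k where "k = card A"
    have "real (card {i \<in> A. g i \<le> e}) \<le> e * real n" if e: "0 < e" for e
    proof -
      have "card {i \<in> A. g i \<le> e} \<le> card {i \<in> insert a A. g i \<le> e}"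
        using insert.hyps by (intro card_mono) auto
      with insert.prems(2)[OF e] show ?thesis by linarith
    qed
    with insert have IH: "(\<Prod>i\<in>A. 1 + 1 / g i) \<le> real ((n + k) choose k)"
      by (simp add: k_def)
    have "{i \<in> insert a A. g i \<le> g a} = insert a A"
      using insert.hyps by auto
    with insert.prems(2)[of "g a"] insert.prems(1)[of a] insert.hyps False have level: "real (Suc k) \<le> g a * real n"
      by (simp add: k_def)
    have ga: "0 < g a" using insert.prems by simp
    have "1 + 1 / g a \<le> 1 + real n / real (Suc k)"
      using level ga by (simp add: field_simps)
    moreover have "0 \<le> (\<Prod>i\<in>A. 1 + 1 / g i)"
      using insert.prems(1) by (intro prod_nonneg add_nonneg_nonneg) (auto intro: less_imp_le)
    ultimately have "(1 + 1 / g a) * (\<Prod>i\<in>A. 1 + 1 / g i) \<le> (1 + real n / real (Suc k)) * real ((n + k) choose k)"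
      using IH by (intro mult_mono) auto
    also have "\<dots> = real ((n + Suc k) choose Suc k)"
    proof -
      have "real (Suc k) * real (Suc (n + k) choose Suc k) = real (Suc (n + k)) * real ((n + k) choose k)"
        by (metis Suc_times_binomial of_nat_mult)
      then show ?thesis by (simp add: field_simps del: binomial_Suc_Suc)
    qed
    finally show ?thesis using insert.hyps False by (simp add: k_def del: binomial_Suc_Suc)
  qed
qed

text \<open>Again induction in increasing order of \<open>g\<close>: the level set of
  \<open>g a\<close> carries the whole weight \<open>w a + s\<close>, so the new term is at most
  \<open>n * w a / (n + w a + s)\<close>. This is the area of a rectangle below the graph of
  \<open>n / u\<close> for \<open>u\<close> between \<open>n + s\<close> and
  \<open>n + s + w a\<close>; adding up gives the integral.\<close>

lemma weighted_sum_le_ln: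
  fixes g w :: "'a \<Rightarrow> real"
  assumes "finite A" "0 < n" "\<And>i. i \<in> A \<Longrightarrow> 0 < g i" "\<And>i. i \<in> A \<Longrightarrow> 0 \<le> w i"
    and "\<And>e. 0 < e \<Longrightarrow> (\<Sum>i | i \<in> A \<and> g i \<le> e. w i) \<le> e * n"
  shows "(\<Sum>i\<in>A. w i / (1 + g i)) \<le> n * (ln (n + (\<Sum>i\<in>A. w i)) - ln n)"
  using assms(1,3,4,5)
proof (induction A rule: finite_ranking_induct[where f = g])
  case empty
  then show ?case by simp
next
  case (insert a A)
  show ?case
  proof (cases "a \<in> A")
    case True
    with insert show ?thesis by (simp add: insert_absorb)
  next
    case False
    define s where "s = (\<Sum>i\<in>A. w i)"
    have s: "0 \<le> s" using insert.prems by (auto simp: s_def intro: sum_nonneg)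
    have "(\<Sum>i | i \<in> A \<and> g i \<le> e. w i) \<le> e * n" if e: "0 < e" for e
    proof -
      have "(\<Sum>i | i \<in> A \<and> g i \<le> e. w i) \<le> (\<Sum>i | i \<in> insert a A \<and> g i \<le> e. w i)"
        using insert by (intro sum_mono2) auto
      with insert.prems(3)[OF e] show ?thesis by linarith
    qed
    with insert have IH: "(\<Sum>i\<in>A. w i / (1 + g i)) \<le> n * (ln (n + s) - ln n)"
      by (simp add: s_def)
    have "{i. i \<in> insert a A \<and> g i \<le> g a} = insert a A"
      using insert.hyps by auto
    with insert.prems(3)[of "g a"] insert.prems(1)[of a] insert.hyps False have level: "w a + s \<le> g a * n"
      by (simp add: s_def)
    have a: "0 < g a" "0 \<le> w a" using insert.prems by simp_all
    have "ln (n + s) - ln (n + (w a + s)) \<le> ((n + s) - (n + (w a + s))) / (n + (w a + s))"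
      using a s \<open>0 < n\<close> by (intro ln_diff_le) auto
    then have ln_step: "w a / (n + (w a + s)) \<le> ln (n + (w a + s)) - ln (n + s)"
      by (simp add: field_simps)
    have "w a / (1 + g a) \<le> w a / ((n + (w a + s)) / n)"
      using a s level \<open>0 < n\<close> by (intro divide_left_mono) (auto simp: field_simps intro: add_pos_nonneg)
    also have "\<dots> = n * (w a / (n + (w a + s)))" by simp
    also have "\<dots> \<le> n * (ln (n + (w a + s)) - ln (n + s))"
      using ln_step \<open>0 < n\<close> by (intro mult_left_mono) auto
    finally show ?thesis
      using IH insert.hyps False by (simp add: s_def[symmetric] algebra_simps)
  qed
qed

lemma geometric_mean_le_of_levels:
  fixes g w :: "nat \<Rightarrow> real"
  assumes n: "0 < n" and r: "1 \<le> r"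
    and g: "\<And>i. i < n \<Longrightarrow> 0 < g i"
    and w: "\<And>i. i < n \<Longrightarrow> 1 \<le> w i" "\<And>i. i < n \<Longrightarrow> w i \<le> r"
    and level: "\<And>e. 0 < e \<Longrightarrow> (\<Sum>i | i < n \<and> g i \<le> e. w i) \<le> e * real n"
  shows "root n (\<Prod>i<n. w i) \<le> 4 * (1 + ln r) * root n (\<Prod>i<n. g i)"
proof -
  \<comment> \<open>Each weight is at least 1, so the weighted level bound also bounds the number of
    agents.\<close>
  have "real (card {i \<in> {..<n}. g i \<le> e}) \<le> e * real n" if e: "0 < e" for e
  proof -
    have "real (card {i. i < n \<and> g i \<le> e}) \<le> (\<Sum>i | i < n \<and> g i \<le> e. w i)"
      using sum_mono[of "{i. i < n \<and> g i \<le> e}" "\<lambda>_. 1" w] w by simp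
    with level[OF e] show ?thesis by simp
  qed
  then have "(\<Prod>i<n. 1 + 1 / g i) \<le> real ((n + n) choose n)"
    using prod_one_plus_inverse_le[of "{..<n}" n g] n g by simp
  also have "\<dots> \<le> real (2 ^ (n + n))"
    using binomial_le_pow2 of_nat_le_iff by blast
  also have "\<dots> = 4 ^ n" by (simp add: power_add flip: power_mult_distrib)
  finally have "root n (\<Prod>i<n. 1 + 1 / g i) \<le> root n (4 ^ n)"
    using n by simp
  then have small: "root n (\<Prod>i<n. 1 + 1 / g i) \<le> 4"
    using n by (simp add: real_root_power_cancel)
  have pos: "0 \<le> w i / (1 + g i)" if "i < n" for i
    using g[OF that] w(1)[OF that] by auto
  have "root n (\<Prod>i<n. w i / (1 + g i)) = (\<Prod>i<n. w i / (1 + g i)) powr (1 / real n)"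
    using n pos by (intro root_powr_inverse prod_nonneg) auto
  also have "\<dots> \<le> (\<Sum>i<n. (w i / (1 + g i)) / real n)"
    using arith_geom_mean[of "{..<n}" "\<lambda>i. w i / (1 + g i)"] pos n by (auto simp: lessThan_empty_iff)
  also have "\<dots> = (\<Sum>i<n. w i / (1 + g i)) / real n"
    by (simp add: sum_divide_distrib)
  also have "\<dots> \<le> ln (real n + (\<Sum>i<n. w i)) - ln (real n)"
  proof -
    have "(\<Sum>i<n. w i / (1 + g i)) \<le> real n * (ln (real n + (\<Sum>i<n. w i)) - ln (real n))"
    proof (rule weighted_sum_le_ln)
      show "0 \<le> w i" if "i \<in> {..<n}" for i using w(1)[of i] that by simp
    qed (use n g level in auto)
    with n show ?thesis by (simp add: field_simps)
  qed
  \<comment> \<open>Both \<open>n\<close> and the sum of \<open>w\<close> are at most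
    \<open>n * r\<close>, the former because \<open>r\<close> is at least 1.\<close>
  also have "\<dots> \<le> ln (real n * (2 * r)) - ln (real n)"
  proof -
    have "0 \<le> (\<Sum>i<n. w i)" using w(1) by (intro sum_nonneg) (auto intro: order_trans[OF zero_le_one])
    moreover have "(\<Sum>i<n. w i) \<le> real n * r" using sum_bounded_above[of "{..<n}" w r] w by simp
    moreover have "real n \<le> real n * r" using r n by simp
    moreover have "real n * (2 * r) = real n * r + real n * r" by simp
    moreover have "0 < real n" using n by simp
    ultimately have "real n + (\<Sum>i<n. w i) \<le> real n * (2 * r)" "0 < real n + (\<Sum>i<n. w i)"
      by linarith+
    then show ?thesis by (simp add: ln_mono)
  qed
  also have "\<dots> = ln 2 + ln r" using n r by (simp add: ln_mult)
  also have "\<dots> \<le> 1 + ln r" using ln_2_less_1 by simp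
  finally have large: "root n (\<Prod>i<n. w i / (1 + g i)) \<le> 1 + ln r" .
  have "(\<Prod>i<n. w i) = (\<Prod>i<n. (1 + 1 / g i) * (w i / (1 + g i)) * g i)"
    using g by (intro prod.cong refl) (force simp: field_simps add_pos_pos)
  also have "\<dots> = (\<Prod>i<n. 1 + 1 / g i) * (\<Prod>i<n. w i / (1 + g i)) * (\<Prod>i<n. g i)"
    by (simp only: prod.distrib)
  finally have "root n (\<Prod>i<n. w i) =
      root n (\<Prod>i<n. 1 + 1 / g i) * root n (\<Prod>i<n. w i / (1 + g i)) * root n (\<Prod>i<n. g i)"
    by (simp only: real_root_mult)
  also have "\<dots> \<le> 4 * (1 + ln r) * root n (\<Prod>i<n. g i)"
  proof -
    have "0 \<le> root n (\<Prod>i<n. w i / (1 + g i))"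
      using n pos by (intro real_root_ge_zero prod_nonneg) auto
    moreover have "0 \<le> root n (\<Prod>i<n. g i)"
      using n g by (intro real_root_ge_zero prod_nonneg) (auto intro: less_imp_le)
    ultimately show ?thesis
      using small large by (intro mult_right_mono mult_mono) auto
  qed
  finally show ?thesis .
qed

text \<open>Hypotheses and conclusion survive dividing \<open>g\<close> and \<open>w\<close> by a
  common positive number. Dividing by the smallest \<open>w\<close> puts all weights between 1 and
  \<open>r\<close>.\<close>

lemma geometric_mean_le_of_levels_scaled:
  fixes g w :: "nat \<Rightarrow> real"
  assumes n: "0 < n" and r: "1 \<le> r"
    and g: "\<And>i. i < n \<Longrightarrow> 0 < g i" and w: "\<And>i. i < n \<Longrightarrow> 0 < w i"
    and ratio: "\<And>i j. i < n \<Longrightarrow> j < n \<Longrightarrow> w i \<le> r * w j"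
    and level: "\<And>e. 0 < e \<Longrightarrow> (\<Sum>i | i < n \<and> g i \<le> e. w i) \<le> e * real n"
  shows "root n (\<Prod>i<n. w i) \<le> 4 * (1 + ln r) * root n (\<Prod>i<n. g i)"
proof -
  define m where "m = Min (w ` {..<n})"
  have m_in: "m \<in> w ` {..<n}" unfolding m_def using n by (intro Min_in) auto
  have m_le: "m \<le> w i" if "i < n" for i using that by (simp add: m_def)
  have m: "0 < m" using m_in w by auto
  have "(\<Sum>i | i < n \<and> g i / m \<le> e. w i / m) \<le> e * real n" if "0 < e" for e
    using level[of "e * m"] m that by (simp add: divide_le_eq flip: sum_divide_distrib) (simp add: mult_ac)
  then have "root n (\<Prod>i<n. w i / m) \<le> 4 * (1 + ln r) * root n (\<Prod>i<n. g i / m)"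
    using n r g m m_le m_in ratio
    by (intro geometric_mean_le_of_levels) (auto simp: divide_le_eq)
  with m n show ?thesis
    by (simp add: prod_dividef real_root_divide real_root_power_cancel field_simps)
qed

section \<open>Partial utilities and sums of extended logarithms\<close>

lemma utility_before_Suc:
  "utility_before I x (Suc t) i = utility_before I x t i + value_of I i t * x i t"
  by (simp add: utility_before_def mult.commute)

lemma utility_eq_utility_before: "utility I x i = utility_before I x (items I) i"
  by (simp add: utility_def utility_before_def)

lemma myopic_greedy_allocation: "myopic_greedy I x \<Longrightarrow> allocation I x"
  by (simp add: myopic_greedy_def allocation_def)

lemma utility_before_mono:
  assumes "valid_instance I" "allocation I x" "i < agents I" "s \<le> t" "t \<le> items I"
  shows "utility_before I x s i \<le> utility_before I x t i"
  unfolding utility_before_def using assms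
  by (intro sum_mono2) (auto simp: valid_instance_def allocation_def item_feasible_def)

lemma utility_before_nonneg:
  assumes "valid_instance I" "allocation I x" "i < agents I" "t \<le> items I"
  shows "0 \<le> utility_before I x t i"
  using utility_before_mono[OF assms(1-3) _ assms(4), of 0] by (simp add: utility_before_def)

lemma utility_nonneg:
  assumes "valid_instance I" "allocation I x" "i < agents I"
  shows "0 \<le> utility I x i"
  using utility_before_nonneg[OF assms] by (simp add: utility_eq_utility_before)

lemma sum_elog_ereal:
  assumes "\<And>i. i \<in> A \<Longrightarrow> 0 < f i"
  shows "(\<Sum>i\<in>A. elog (ereal (f i))) = ereal (\<Sum>i\<in>A. ln (f i))"
proof -
  have "(\<Sum>i\<in>A. elog (ereal (f i))) = (\<Sum>i\<in>A. ereal (ln (f i)))"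
    using assms by (intro sum.cong refl) (force simp: elog_def)
  then show ?thesis by simp
qed

lemma sum_elog_eq_MInfty:
  assumes "finite A" "i \<in> A" "f i \<le> 0"
  shows "(\<Sum>j\<in>A. elog (ereal (f j))) = -\<infinity>"
proof -
  \<comment> \<open>In \<open>ereal\<close>, \<infinity> absorbs even \<open>-\<infinity>\<close>
    under addition, so it has to be excluded for the remaining terms.\<close>
  have "(\<Sum>j\<in>A - {i}. elog (ereal (f j))) \<noteq> \<infinity>"
    by (subst sum_Pinfty) (auto simp: elog_def)
  moreover have "elog (ereal (f i)) = -\<infinity>" using assms by (simp add: elog_def)
  ultimately show ?thesis using assms by (simp add: sum.remove[of A i])
qed

section \<open>Greedy as water filling\<close>

locale greedy_run =
  fixes I :: nw_instance and x :: alloc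
  assumes valid: "valid_instance I" and binary: "binary_instance I"
    and greedy: "myopic_greedy I x"
begin

abbreviation level :: "nat \<Rightarrow> nat \<Rightarrow> real" where
  "level t i \<equiv> utility_before I x t i"

lemma alloc: "allocation I x"
  by (rule myopic_greedy_allocation[OF greedy])

lemma x_nonneg: "i < agents I \<Longrightarrow> t < items I \<Longrightarrow> 0 \<le> x i t"
  using alloc by (simp add: allocation_def item_feasible_def)

lemma value_nonneg: "i < agents I \<Longrightarrow> t < items I \<Longrightarrow> 0 \<le> value_of I i t"
  using valid by (simp add: valid_instance_def)

lemma value_eq:
  assumes "i < agents I" "j < agents I" "t < items I" "0 < value_of I i t" "0 < value_of I j t"
  shows "value_of I i t = value_of I j t"
proof -
  obtain w where "\<forall>i<agents I. value_of I i t \<in> {0, w}"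
    using binary assms(3) unfolding binary_instance_def by blast
  with assms have "value_of I i t = w" "value_of I j t = w" by force+
  then show ?thesis by simp
qed

text \<open>The index set of \<open>greedy_objective\<close>: the agents who can have positive
  utility after item \<open>t\<close>.\<close>

definition active :: "nat \<Rightarrow> nat set" where
  "active t = {i. i < agents I \<and> (level t i > 0 \<or> value_of I i t > 0)}"

lemma finite_active: "finite (active t)"
  by (simp add: active_def)

lemma greedy_objective_eq:
  "greedy_objective I x t z = (\<Sum>i\<in>active t. elog (ereal (level t i + value_of I i t * z i)))"
  by (simp add: greedy_objective_def active_def)

text \<open>Splitting the item equally makes every term of the objective finite, whereas an active
  agent left at level 0 would make it \<open>-\<infinity>\<close>.\<close>

lemma level_Suc_pos:
  assumes t: "t < items I" and i: "i \<in> active t"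
  shows "0 < level (Suc t) i"
proof (rule ccontr)
  assume neg: "\<not> 0 < level (Suc t) i"
  define z where "z = (\<lambda>_::nat. item_supply I t / real (agents I))"
  have N: "0 < agents I" and s: "0 < item_supply I t"
    using valid t by (auto simp: valid_instance_def)
  then have z: "0 < z j" for j by (simp add: z_def)
  have feas: "item_feasible I t z" using N s by (simp add: item_feasible_def z_def)
  have "0 < level t j + value_of I j t * z j" if "j \<in> active t" for j
    using that z[of j] value_nonneg[of j t] t utility_before_nonneg[OF valid alloc, of j t]
    by (auto simp: active_def intro: add_pos_nonneg add_nonneg_pos)
  then have "greedy_objective I x t z \<noteq> -\<infinity>"
    by (simp add: greedy_objective_eq sum_elog_ereal)
  moreover have "greedy_objective I x t (\<lambda>i. x i t) = -\<infinity>"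
    unfolding greedy_objective_eq
    using neg i by (intro sum_elog_eq_MInfty[OF finite_active]) (auto simp: utility_before_Suc)
  ultimately show False
    using greedy feas t unfolding myopic_greedy_def by fastforce
qed

text \<open>Moves the greedy choice to real logarithms for the exchange arguments below. The
  assumption \<open>pos\<close> keeps \<open>elog\<close> finite, where it agrees with
  \<open>ln\<close>.\<close>

lemma greedy_optimal_ln:
  assumes t: "t < items I" and z: "item_feasible I t z"
    and pos: "\<And>i. i \<in> active t \<Longrightarrow> 0 < level t i + value_of I i t * z i"
  shows "(\<Sum>i\<in>active t. ln (level t i + value_of I i t * z i)) \<le> (\<Sum>i\<in>active t. ln (level (Suc t) i))"
proof -
  have "greedy_objective I x t z \<le> greedy_objective I x t (\<lambda>i. x i t)"
    using greedy t z by (simp add: myopic_greedy_def)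
  moreover have "greedy_objective I x t z = ereal (\<Sum>i\<in>active t. ln (level t i + value_of I i t * z i))"
    unfolding greedy_objective_eq using pos by (rule sum_elog_ereal)
  moreover have "greedy_objective I x t (\<lambda>i. x i t) = ereal (\<Sum>i\<in>active t. ln (level (Suc t) i))"
    unfolding greedy_objective_eq utility_before_Suc
    using level_Suc_pos[OF t] by (intro sum_elog_ereal) (simp add: utility_before_Suc)
  ultimately show ?thesis by simp
qed

text \<open>Units that are left over or held by agents without value for them could go to
  \<open>k\<close>, which would strictly increase the objective.\<close>

lemma supply_exhausted:
  assumes t: "t < items I" and k: "k < agents I" "0 < value_of I k t"
  shows "item_supply I t \<le> (\<Sum>i | i < agents I \<and> 0 < value_of I i t. x i t)"
proof (rule ccontr)
  define V where "V = {i. i < agents I \<and> 0 < value_of I i t}"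
  assume "\<not> ?thesis"
  then have less: "(\<Sum>i\<in>V. x i t) < item_supply I t" by (simp add: V_def)
  define d where "d = item_supply I t - (\<Sum>i\<in>V. x i t)"
  have d: "0 < d" using less by (simp add: d_def)
  \<comment> \<open>Agents outside \<open>V\<close> lose their share, which is worthless to them;
    thus only the level of \<open>k\<close> changes.\<close>
  define z where "z = (\<lambda>i. if i \<in> V then x i t + (if i = k then d else 0) else 0)"
  have kV: "k \<in> V" and finV: "finite V" using k by (auto simp: V_def)
  have "(\<Sum>i<agents I. z i) = (\<Sum>i\<in>V. x i t + (if i = k then d else 0))"
    unfolding z_def by (subst sum.inter_restrict[symmetric]) (auto simp: V_def intro!: sum.cong)
  also have "\<dots> = item_supply I t" using kV finV by (simp add: sum.distrib d_def)
  finally have feas: "item_feasible I t z"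
    using d x_nonneg[OF _ t] by (auto simp: item_feasible_def z_def)
  have eq: "level t i + value_of I i t * z i = level (Suc t) i + (if i = k then value_of I k t * d else 0)"
    if "i \<in> active t" for i
    using that value_nonneg[of i t] t kV
    by (auto simp: utility_before_Suc z_def V_def active_def algebra_simps)
  have gain: "0 < value_of I k t * d" using k d by simp
  have k_active: "k \<in> active t" using k by (simp add: active_def)
  have "(\<Sum>i\<in>active t. ln (level (Suc t) i)) < (\<Sum>i\<in>active t. ln (level t i + value_of I i t * z i))"
  proof (rule sum_strict_mono_ex1[OF finite_active])
    show "\<forall>i\<in>active t. ln (level (Suc t) i) \<le> ln (level t i + value_of I i t * z i)"
      using gain level_Suc_pos[OF t] by (auto simp: eq intro!: ln_mono add_pos_pos)
    show "\<exists>i\<in>active t. ln (level (Suc t) i) < ln (level t i + value_of I i t * z i)"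
      using gain level_Suc_pos[OF t k_active] k_active by (intro bexI[of _ k]) (auto simp: eq)
  qed
  moreover have "0 < level t i + value_of I i t * z i" if "i \<in> active t" for i
    using eq[OF that] gain level_Suc_pos[OF t that] by auto
  ultimately show False using greedy_optimal_ln[OF t feas] by fastforce
qed

text \<open>Exchange argument: if \<open>j\<close> ended above \<open>i\<close>, moving a little of
  the item from \<open>j\<close> to \<open>i\<close> would increase the product of their levels,
  since both value it equally.\<close>

lemma receiver_level_le:
  assumes t: "t < items I" and i: "i < agents I" "0 < value_of I i t"
    and j: "j < agents I" "0 < value_of I j t" "0 < x j t"
  shows "level (Suc t) j \<le> level (Suc t) i"
proof (rule ccontr)
  define a b v where "a = level (Suc t) i" and "b = level (Suc t) j" and "v = value_of I j t"
  assume "\<not> ?thesis"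
  then have ab: "a < b" by (simp add: a_def b_def)
  then have ij: "i \<noteq> j" by (auto simp: a_def b_def)
  have v: "0 < v" "value_of I i t = v" using j value_eq[of i j t] i t by (auto simp: v_def)
  \<comment> \<open>The transfer may not exceed what \<open>j\<close> holds. Half the gap keeps
    \<open>v * d\<close> below \<open>b - a\<close>, so the product of the two levels grows by
    \<open>v * d * (b - a - v * d) > 0\<close>.\<close>
  define d where "d = min (x j t) ((b - a) / (2 * v))"
  have d: "0 < d" "d \<le> x j t" using ab v j by (auto simp: d_def)
  have "v * d \<le> v * ((b - a) / (2 * v))" using v by (intro mult_left_mono) (auto simp: d_def)
  then have vd: "0 < v * d" "v * d < b - a" using d v ab by auto
  have a_pos: "0 < a" and active: "i \<in> active t" "j \<in> active t"
    using level_Suc_pos[OF t, of i] i j by (auto simp: a_def active_def)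
  define z where "z = (\<lambda>l. x l t + (if l = i then d else 0) - (if l = j then d else 0))"
  have "(\<Sum>l<agents I. z l) = (\<Sum>l<agents I. x l t)"
    using i j by (simp add: z_def sum.distrib sum_subtractf)
  then have feas: "item_feasible I t z"
    using d ij x_nonneg[OF _ t] alloc t
    by (auto simp: item_feasible_def z_def allocation_def)
  have eq: "level t l + value_of I l t * z l = level (Suc t) l" if "l \<noteq> i" "l \<noteq> j" for l
    using that by (simp add: utility_before_Suc z_def)
  have eq_i: "level t i + value_of I i t * z i = a + v * d"
    using ij v by (simp add: utility_before_Suc z_def a_def algebra_simps)
  have eq_j: "level t j + value_of I j t * z j = b - v * d"
    using ij v by (simp add: utility_before_Suc z_def b_def v_def algebra_simps)
  have split: "(\<Sum>l\<in>active t. f l) = f i + f j + (\<Sum>l\<in>active t - {i} - {j}. f l)" for f :: "nat \<Rightarrow> real"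
    using active ij finite_active by (simp add: sum.remove[of "active t" i] sum.remove[of "active t - {i}" j])
  have pos: "0 < level t l + value_of I l t * z l" if "l \<in> active t" for l
  proof (cases "l = i \<or> l = j")
    case True
    then show ?thesis using eq_i eq_j a_pos vd by auto
  next
    case False
    then show ?thesis using eq level_Suc_pos[OF t that] by auto
  qed
  have "(\<Sum>l\<in>active t - {i} - {j}. ln (level t l + value_of I l t * z l)) =
      (\<Sum>l\<in>active t - {i} - {j}. ln (level (Suc t) l))"
    by (intro sum.cong) (auto simp: eq)
  with greedy_optimal_ln[OF t feas pos] have "ln (a + v * d) + ln (b - v * d) \<le> ln a + ln b"
    unfolding split eq_i eq_j by (simp add: a_def b_def)
  then have "ln ((a + v * d) * (b - v * d)) \<le> ln (a * b)"
    using a_pos ab vd by (simp add: ln_mult)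
  then have "(a + v * d) * (b - v * d) \<le> a * b"
    using a_pos ab vd by (subst (asm) ln_le_cancel_iff) (auto intro!: mult_pos_pos)
  then have "v * d * (b - a - v * d) \<le> 0" by (simp add: algebra_simps)
  then show False using mult_pos_pos[of "v * d" "b - a - v * d"] vd by linarith
qed

section \<open>Greedy utilities against an arbitrary allocation\<close>

lemma utility_pos:
  assumes "i < agents I" "t < items I" "0 < value_of I i t"
  shows "0 < utility I x i"
proof -
  have "0 < level (Suc t) i" using assms by (intro level_Suc_pos) (auto simp: active_def)
  also have "\<dots> \<le> utility I x i"
    unfolding utility_eq_utility_before using assms valid alloc
    by (intro utility_before_mono) auto
  finally show ?thesis .
qed

text \<open>Look at the last item of \<open>W\<close> that \<open>i\<close> receives: its recipients are at most as well off as the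
  poor agent who wants it.\<close>

lemma utility_from_items_wanted_by_poor:
  assumes i: "i < agents I" and e: "0 \<le> e"
    and W: "W = {t. t < items I \<and> (\<exists>j<agents I. 0 < value_of I j t \<and> utility I x j \<le> e)}"
  shows "(\<Sum>t\<in>W. x i t * value_of I i t) \<le> e"
proof (cases "{t \<in> W. 0 < x i t * value_of I i t} = {}")
  case True
  then have "(\<Sum>t\<in>W. x i t * value_of I i t) \<le> 0"
    by (intro sum_nonpos) (auto simp: not_less)
  with e show ?thesis by linarith
next
  case False
  define R where "R = {t \<in> W. 0 < x i t * value_of I i t}"
  have finR: "finite R" by (simp add: R_def W)
  define t where "t = Max R"
  have "t \<in> R" unfolding t_def using finR False by (intro Max_in) (auto simp: R_def)
  then have t: "t < items I" "0 < x i t" "0 < value_of I i t"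
    using x_nonneg[OF i, of t] value_nonneg[OF i, of t] by (auto simp: R_def W zero_less_mult_iff)
  obtain j where j: "j < agents I" "0 < value_of I j t" "utility I x j \<le> e"
    using \<open>t \<in> R\<close> by (auto simp: R_def W)
  have nonneg: "0 \<le> x i s * value_of I i s" if "s < items I" for s
    using x_nonneg[OF i that] value_nonneg[OF i that] by simp
  have "(\<Sum>s\<in>W. x i s * value_of I i s) = (\<Sum>s\<in>R. x i s * value_of I i s)"
    using nonneg by (intro sum.mono_neutral_right) (fastforce simp: R_def W)+
  also have "\<dots> \<le> level (Suc t) i"
    unfolding utility_before_def
    using nonneg t finR by (intro sum_mono2) (auto simp: t_def R_def less_Suc_eq_le)
  also have "\<dots> \<le> level (Suc t) j" using receiver_level_le t i j by blast
  also have "\<dots> \<le> utility I x j"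
    unfolding utility_eq_utility_before using valid alloc j t by (intro utility_before_mono) auto
  finally show ?thesis using j by simp
qed

text \<open>No allocation extracts more from item \<open>t\<close> than its supply times the common
  value \<open>v\<close> of those who want it. Greedy attains this, as it exhausts the supply on
  agents with value \<open>v\<close>.\<close>

lemma supply_le_greedy_value:
  assumes y: "allocation I y" and t: "t < items I" and B: "B \<subseteq> {..<agents I}"
    and k: "k \<in> B" "0 < value_of I k t"
  shows "(\<Sum>i\<in>B. y i t * value_of I i t) \<le> (\<Sum>i<agents I. x i t * value_of I i t)"
proof -
  define v where "v = value_of I k t"
  have kN: "k < agents I" and v: "0 < v" using k B by (auto simp: v_def)
  have y_nonneg: "0 \<le> y i t" if "i < agents I" for i
    using y t that by (simp add: allocation_def item_feasible_def)
  have val: "value_of I i t = (if 0 < value_of I i t then v else 0)" if "i < agents I" for i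
    using value_eq[OF that kN t] value_nonneg[OF that t] k by (auto simp: v_def)
  have "(\<Sum>i\<in>B. y i t * value_of I i t) \<le> (\<Sum>i\<in>B. y i t * v)"
    using B y_nonneg v by (intro sum_mono mult_left_mono) (auto simp: val)
  also have "\<dots> \<le> (\<Sum>i<agents I. y i t * v)"
    using B y_nonneg v by (intro sum_mono2) auto
  also have "\<dots> \<le> item_supply I t * v"
    using y t v by (auto simp: allocation_def item_feasible_def simp flip: sum_distrib_right)
  also have "\<dots> \<le> (\<Sum>i | i < agents I \<and> 0 < value_of I i t. x i t) * v"
    using supply_exhausted[OF t kN k(2)] v by (intro mult_right_mono) auto
  also have "\<dots> = (\<Sum>i | i < agents I \<and> 0 < value_of I i t. x i t * value_of I i t)"
    unfolding sum_distrib_right using val by (intro sum.cong refl) fastforce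
  also have "\<dots> \<le> (\<Sum>i<agents I. x i t * value_of I i t)"
    using x_nonneg[OF _ t] value_nonneg[OF _ t] by (intro sum_mono2) auto
  finally show ?thesis .
qed

text \<open>Under \<open>y\<close>, poor agents draw value only from the items in \<open>W\<close>.
  On each of these greedy creates at least as much total value, and each agent gets at most
  \<open>e\<close> from \<open>W\<close> under greedy. For an optimal \<open>y\<close> this is the
  level bound required by \<open>geometric_mean_le_of_levels_scaled\<close>.\<close>

lemma utility_of_poor_le:
  assumes y: "allocation I y" and e: "0 \<le> e"
  shows "(\<Sum>i | i < agents I \<and> utility I x i \<le> e. utility I y i) \<le> e * real (agents I)"
proof -
  define B where "B = {i. i < agents I \<and> utility I x i \<le> e}"
  define W where "W = {t. t < items I \<and> (\<exists>j<agents I. 0 < value_of I j t \<and> utility I x j \<le> e)}"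
  have W_sub: "W \<subseteq> {..<items I}" by (auto simp: W_def)
  \<comment> \<open>A poor agent who values an item is itself a witness that the item lies in
    \<open>W\<close>.\<close>
  have outside: "y i t * value_of I i t = 0" if "i \<in> B" "t < items I" "t \<notin> W" for i t
    using that value_nonneg[of i t] by (force simp: B_def W_def)
  have "(\<Sum>i\<in>B. utility I y i) = (\<Sum>t<items I. \<Sum>i\<in>B. y i t * value_of I i t)"
    unfolding utility_def by (rule sum.swap)
  also have "\<dots> = (\<Sum>t\<in>W. \<Sum>i\<in>B. y i t * value_of I i t)"
    using outside by (intro sum.mono_neutral_right) (auto simp: W_sub intro!: sum.neutral)
  also have "\<dots> \<le> (\<Sum>t\<in>W. \<Sum>i<agents I. x i t * value_of I i t)"
  proof (rule sum_mono)
    fix t assume "t \<in> W"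
    then show "(\<Sum>i\<in>B. y i t * value_of I i t) \<le> (\<Sum>i<agents I. x i t * value_of I i t)"
      using supply_le_greedy_value[OF y, of t B] by (auto simp: W_def B_def)
  qed
  also have "\<dots> = (\<Sum>i<agents I. \<Sum>t\<in>W. x i t * value_of I i t)"
    by (rule sum.swap)
  also have "\<dots> \<le> (\<Sum>i<agents I. e)"
    using utility_from_items_wanted_by_poor[OF _ e W_def] by (intro sum_mono) auto
  finally show ?thesis by (simp add: B_def mult.commute)
qed

end

section \<open>Existence of an optimal allocation; the impartiality ratio\<close>

lemma nash_welfare_nonneg:
  assumes "valid_instance I" "allocation I x"
  shows "0 \<le> nash_welfare I x"
  using assms utility_nonneg
  by (auto simp: nash_welfare_def valid_instance_def intro!: real_root_ge_zero prod_nonneg)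

text \<open>A continuous function attains its maximum on a compact set. Allocations are unrestricted
  outside the ranges of agents and items, so compactness requires intersecting with the box
  \<open>K\<close>, compact by Tychonoff's theorem.\<close>

lemma nash_optimal_exists:
  assumes valid: "valid_instance I"
  shows "\<exists>y. nash_optimal I y"
proof -
  define K :: "alloc set" where
    "K = (\<Pi>\<^sub>E i\<in>UNIV. \<Pi>\<^sub>E t\<in>UNIV. if t < items I then {0..item_supply I t} else {0})"
  have "compact K"
  proof -
    have "compactin (product_topology (\<lambda>t::nat. euclidean) UNIV)
        (\<Pi>\<^sub>E t\<in>UNIV. if t < items I then {0..item_supply I t} else {0})"
      unfolding compactin_PiE by auto
    then have "compact (\<Pi>\<^sub>E t\<in>UNIV. if t < items I then {0..item_supply I t} else {0::real})"
      by (simp add: euclidean_product_topology)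
    then have "compactin (product_topology (\<lambda>i::nat. euclidean) UNIV) K"
      unfolding K_def compactin_PiE by auto
    then show ?thesis by (simp add: euclidean_product_topology)
  qed
  have cont: "continuous_on S (\<lambda>x::alloc. x i t)" for S i t
    by (rule continuous_on_product_then_coordinatewise[where f = "\<lambda>x. x i" and i = t,
          OF continuous_on_product_then_coordinatewise[where f = "\<lambda>x. x", OF continuous_on_id]])
  have "closed {x::alloc. allocation I x}"
  proof -
    have "{x. allocation I x} =
      (\<Inter>t\<in>{..<items I}. (\<Inter>i\<in>{..<agents I}. {x. 0 \<le> x i t}) \<inter> {x. (\<Sum>i<agents I. x i t) \<le> item_supply I t})"
      by (auto simp: allocation_def item_feasible_def)
    also have "closed \<dots>"
      by (intro closed_INT closed_Int ballI closed_Collect_le continuous_on_const continuous_on_sum cont)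
    finally show ?thesis .
  qed
  with \<open>compact K\<close> have compact: "compact (K \<inter> {x. allocation I x})"
    by (rule compact_Int_closed)
  have "(\<lambda>_ _. 0) \<in> K \<inter> {x. allocation I x}"
    using valid by (auto simp: K_def allocation_def item_feasible_def valid_instance_def less_imp_le)
  then have nonempty: "K \<inter> {x. allocation I x} \<noteq> {}" by blast
  have "continuous_on (K \<inter> {x. allocation I x}) (nash_welfare I)"
    unfolding nash_welfare_def utility_def
    by (intro continuous_intros cont)
  from continuous_attains_sup[OF compact nonempty this] obtain y where
    y: "allocation I y" and max: "\<And>x. x \<in> K \<Longrightarrow> allocation I x \<Longrightarrow> nash_welfare I x \<le> nash_welfare I y"
    by auto
  have "nash_welfare I x \<le> nash_welfare I y" if x: "allocation I x" for x
  proof -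
    \<comment> \<open>Truncation moves any allocation into \<open>K\<close> and preserves its Nash
      welfare.\<close>
    define x' where "x' = (\<lambda>i t. if i < agents I \<and> t < items I then x i t else 0)"
    have x': "allocation I x'"
      using x by (auto simp: x'_def allocation_def item_feasible_def)
    have "x i t \<le> item_supply I t" if "i < agents I" "t < items I" for i t
    proof -
      have "x i t \<le> (\<Sum>i<agents I. x i t)"
        using x that by (intro member_le_sum) (auto simp: allocation_def item_feasible_def)
      with x that show ?thesis by (fastforce simp: allocation_def item_feasible_def)
    qed
    then have "x' \<in> K"
      using x valid
      by (auto simp: K_def x'_def allocation_def item_feasible_def valid_instance_def less_imp_le)
    from max[OF this x'] show ?thesis
      by (simp add: nash_welfare_def utility_def x'_def)
  qed
  with y show ?thesis by (auto simp: nash_optimal_def)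
qed

lemma opt_nash_welfare_eq:
  assumes "nash_optimal I y"
  shows "opt_nash_welfare I = nash_welfare I y"
  unfolding opt_nash_welfare_def using assms
  by (intro cSup_eq_maximum) (auto simp: nash_optimal_def)

lemma impartiality_ratio_ge_1: "1 \<le> impartiality_ratio I"
  by (auto simp: impartiality_ratio_def intro!: Inf_greatest)

lemma utility_pos_if_nash_welfare_pos:
  assumes "valid_instance I" "allocation I y" "0 < nash_welfare I y" "i < agents I"
  shows "0 < utility I y i"
proof -
  have "0 < (\<Prod>i<agents I. utility I y i)"
    using assms by (simp add: nash_welfare_def valid_instance_def)
  then have "utility I y i \<noteq> 0"
    using assms by (metis finite_lessThan lessThan_iff less_irrefl prod_zero_iff)
  with utility_nonneg[OF assms(1,2,4)] show ?thesis by simp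
qed

section \<open>Comparison with the optimum\<close>

context greedy_run
begin

text \<open>Positive welfare of \<open>y\<close> means that \<open>i\<close> values some item, and
  greedy leaves no such agent at 0.\<close>

lemma utility_pos_of_positive_optimum:
  assumes "allocation I y" "0 < nash_welfare I y" "i < agents I"
  shows "0 < utility I x i"
proof -
  have "0 < utility I y i" by (rule utility_pos_if_nash_welfare_pos[OF valid assms])
  then have "(\<Sum>t<items I. y i t * value_of I i t) \<noteq> 0" by (simp add: utility_def)
  then obtain t where t: "t < items I" "y i t * value_of I i t \<noteq> 0"
    by (rule sum.not_neutral_contains_not_neutral) simp
  then have "0 < value_of I i t" using value_nonneg[OF assms(3) t(1)] by auto
  then show ?thesis by (rule utility_pos[OF assms(3) t(1)])
qed

lemma nash_welfare_pos:
  assumes "allocation I y" "0 < nash_welfare I y"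
  shows "0 < nash_welfare I x"
  using valid utility_pos_of_positive_optimum[OF assms]
  by (auto simp: nash_welfare_def valid_instance_def intro!: real_root_gt_zero prod_pos)

lemma nash_welfare_le:
  assumes y: "nash_optimal I y" and pos: "0 < nash_welfare I y"
    and r: "impartiality_ratio I = ereal r"
  shows "nash_welfare I y \<le> 4 * (1 + ln r) * nash_welfare I x"
proof -
  have N: "0 < agents I" using valid by (simp add: valid_instance_def)
  have y_alloc: "allocation I y" using y by (simp add: nash_optimal_def)
  note y_pos = utility_pos_if_nash_welfare_pos[OF valid y_alloc pos]
  note x_pos = utility_pos_of_positive_optimum[OF y_alloc pos]
  have "1 \<le> r" using impartiality_ratio_ge_1[of I] r by simp
  moreover have "utility I y i \<le> r * utility I y j" if ij: "i < agents I" "j < agents I" for i j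
  proof -
    \<comment> \<open>The quotient is a lower bound of all admissible \<open>\<mu>\<close>, hence at
      most their infimum.\<close>
    have "ereal (utility I y i / utility I y j) \<le> impartiality_ratio I"
      unfolding impartiality_ratio_def
    proof (rule Inf_greatest)
      fix u assume "u \<in> {ereal \<mu> | \<mu>. 1 \<le> \<mu> \<and> impartial_instance I \<mu>}"
      then obtain \<mu> where \<mu>: "u = ereal \<mu>" "impartial_instance I \<mu>" by auto
      then have "utility I y i \<le> \<mu> * utility I y j"
        using y ij by (auto simp: impartial_instance_def impartial_allocation_def)
      then show "ereal (utility I y i / utility I y j) \<le> u"
        using y_pos[OF ij(2)] \<mu> by (simp add: divide_le_eq)
    qed
    then show ?thesis using r y_pos[OF ij(2)] by (simp add: divide_le_eq)
  qed
  ultimately show ?thesis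
    unfolding nash_welfare_def
    using N x_pos y_pos utility_of_poor_le[OF y_alloc]
    by (intro geometric_mean_le_of_levels_scaled) auto
qed

end

theorem theorem4:
  shows "\<exists>C::real. C > 0 \<and>
    competitive myopic_greedy
      (\<lambda>I. ereal C * (1 + elog (impartiality_ratio I)))
      {I. valid_instance I \<and> binary_instance I}"
proof (intro exI conjI)
  show "(0::real) < 4" by simp
  show "competitive myopic_greedy (\<lambda>I. ereal 4 * (1 + elog (impartiality_ratio I)))
      {I. valid_instance I \<and> binary_instance I}"
    unfolding competitive_def
  proof (intro ballI allI impI)
    fix I x
    assume "I \<in> {I. valid_instance I \<and> binary_instance I}" and greedy: "myopic_greedy I x"
    then interpret greedy_run I x by unfold_locales auto
    obtain y where y: "nash_optimal I y" using nash_optimal_exists[OF valid] by blast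
    note opt = opt_nash_welfare_eq[OF y]
    have x_nonneg: "0 \<le> nash_welfare I x" by (rule nash_welfare_nonneg[OF valid alloc])
    show "ereal (opt_nash_welfare I) \<le> ereal 4 * (1 + elog (impartiality_ratio I)) * ereal (nash_welfare I x)"
    proof (cases "0 < nash_welfare I y")
      case False
      \<comment> \<open>With optimum 0, it suffices that the right-hand side is nonnegative, which
        holds because the ratio is at least 1.\<close>
      then have "ereal (opt_nash_welfare I) \<le> 0" by (simp add: opt)
      also have "0 \<le> ereal 4 * (1 + elog (impartiality_ratio I)) * ereal (nash_welfare I x)"
      proof -
        have "0 \<le> elog (impartiality_ratio I)"
          using impartiality_ratio_ge_1[of I] by (cases "impartiality_ratio I") (auto simp: elog_def)
        with x_nonneg show ?thesis by simp
      qed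
      finally show ?thesis .
    next
      case pos: True
      have x_pos: "0 < nash_welfare I x"
        using nash_welfare_pos[OF _ pos] y by (simp add: nash_optimal_def)
      show ?thesis
      proof (cases "impartiality_ratio I")
        case (real r)
        then have "1 \<le> r" using impartiality_ratio_ge_1[of I] by simp
        then show ?thesis using nash_welfare_le[OF y pos real] by (simp add: opt real elog_def one_ereal_def)
      next
        case PInf
        \<comment> \<open>The bound is infinite here only because greedy has positive welfare:
          \<open>\<infinity> * 0\<close> would be 0.\<close>
        then show ?thesis using x_pos by (simp add: elog_def)
      next
        case MInf
        then show ?thesis using impartiality_ratio_ge_1[of I] by simp
      qed
    qed
  qed
qed

end
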